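(* Let $S$ be a finite $E$-unitary inverse semigroup acting on a ring $A$ via an action $\beta=(A_s,\beta_s)_{s\in S}$ that is unital and injective. For $s\in S$ define $$A_{\sigma(s)}=\sum_{t\in\sigma(s)}A_t,\qquad \alpha_{\sigma(s)}=\sum_{t\in\sigma(s)}\beta_t .$$ Then $\alpha=(A_g,\alpha_g)_{g\in G}$ is a unital partial action of the group $G=S/\sigma$ on $A$.
   Context: Rings are associative. An inverse semigroup is a semigroup $S$ in which every $s$ has a unique $s^{-1}$ with $ss^{-1}s=s$, $s^{-1}ss^{-1}=s^{-1}$; $E(S)$ is its set of idempotents. Natural partial order: $s\preceq t$ iff $s=tf$ for some $f\in E(S)$. $S$ is $E$-unitary if $e\in E(S)$ and $e\preceq s$ imply $s\in E(S)$. The relation $s\,\sigma\,t$ iff there is $u\in S$ with $u\preceq s$ and $u\preceq t$ is the minimum group congruence of $S$, so $S/\sigma$ is a group; $\sigma(s)$ is the class of $s$, regarded both as a subset of $S$ and as an element of $S/\sigma$. Action: $A$ is an algebra over a fixed commutative ring $k$. An action of $S$ on $A$ is a collection $\beta=(A_s,\beta_s)_{s\in S}$ of two-sided ideals $A_s$ of $A$ and $k$-algebra isomorphisms $\beta_s:A_{s^{-1}}\to A_s$ such that $A=\sum_{e\in E(S)}A_e$ and $\beta_s(\beta_t(a))=\beta_{st}(a)$ for all $s,t\in S$ and $a\in A_{(st)^{-1}}=\beta_t^{-1}(A_t\cap A_{s^{-1}})$. It is unital if each $A_s$ is generated by a central idempotent $1_s$ of $A$ (so $A_s=1_sA=A1_s$),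 and injective if $\beta_{s}=\beta_{t}$ implies $s=t$. The map $\sum_{t\in\sigma(s)}\beta_t$ is the map $A_{\sigma(s)^{-1}}=\sum_{t\in\sigma(s)}A_{t^{-1}}\to A_{\sigma(s)}$ sending $\sum_t x_t$ (with $x_t\in A_{t^{-1}}$) to $\sum_t\beta_t(x_t)$. For $\sigma$-related $t$'s the maps $\beta_t$ are pairwise compatible (they, and their inverses, agree on common domains), and this map is a well-defined ring isomorphism. A partial action of a group $G$ on a ring $A$ is a collection $\alpha=(A_g,\alpha_g)_{g\in G}$ of ideals $A_g$ of $A$ and ring isomorphisms $\alpha_g:A_{g^{-1}}\to A_g$ such that (P1) $A_{1_G}=A$ and $\alpha_{1_G}=\mathrm{Id}_A$; (P2) $\alpha_h^{-1}(A_{g^{-1}}\cap A_h)\subseteq A_{(gh)^{-1}}$ for all $g,h\in G$; (P3) $\alpha_g\circ\alpha_h(x)=\alpha_{gh}(x)$ for all $g,h\in G$ and $x\in\alpha_h^{-1}(A_{g^{-1}}\cap A_h)$. It is unital if every $A_g$ is a unital ideal (generated by a central idempotent of $A$). *)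

theory Defs
  imports "HOL.Modules" "HOL-Algebra.Group"
begin

section \<open>Inverse semigroups\<close>

class inverse_semigroup = semigroup_mult +
  assumes unique_generalized_inverse: "\<exists>!t. s * t * s = s \<and> t * s * t = t"

definition sinv :: "'s::inverse_semigroup \<Rightarrow> 's" where
  "sinv s = (THE t. s * t * s = s \<and> t * s * t = t)"

definition idems :: "'s::inverse_semigroup set" where
  "idems = {e. e * e = e}"

definition nat_le :: "'s::inverse_semigroup \<Rightarrow> 's \<Rightarrow> bool"  (infix \<open>\<preceq>\<close> 50) where
  "s \<preceq> t \<longleftrightarrow> (\<exists>f\<in>idems. s = t * f)"

class E_unitary_inverse_semigroup = inverse_semigroup +
  assumes E_unitary: "e \<in> idems \<Longrightarrow> e \<preceq> s \<Longrightarrow> s \<in> idems"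

definition sigma :: "('s::inverse_semigroup \<times> 's) set" where
  "sigma = {(s, t). \<exists>u. u \<preceq> s \<and> u \<preceq> t}"

text \<open>The quotient \<open>S/\<sigma>\<close>, whose elements are the \<open>\<sigma>\<close>-classes as subsets of \<open>S\<close>. Because \<open>\<sigma>\<close> is
  a congruence for which any two idempotents are related, the unions below are unions of a
  single class: that of a product of representatives, respectively that of the idempotents.\<close>

definition max_group_image :: "'s::inverse_semigroup set monoid" where
  "max_group_image =
     \<lparr> carrier = UNIV // sigma,
       mult = (\<lambda>C D. \<Union>s\<in>C. \<Union>t\<in>D. sigma `` {s * t}),
       one = (\<Union>e\<in>idems. sigma `` {e}) \<rparr>"


section \<open>Rings, algebras and ideals\<close>

text \<open>The class \<^class>\<open>ring\<close> consists of the associative rings, not necessarily with unit.\<close>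

locale assoc_algebra = module scale
  for scale :: "'k::comm_ring_1 \<Rightarrow> 'a::ring \<Rightarrow> 'a" +
  assumes scale_mult_left: "scale c (x * y) = scale c x * y"
    and scale_mult_right: "scale c (x * y) = x * scale c y"

definition ring_ideal :: "'a::ring set \<Rightarrow> bool" where
  "ring_ideal I \<longleftrightarrow>
     0 \<in> I \<and> (\<forall>x\<in>I. \<forall>y\<in>I. x + y \<in> I) \<and> (\<forall>x\<in>I. - x \<in> I) \<and>
     (\<forall>a. \<forall>x\<in>I. a * x \<in> I \<and> x * a \<in> I)"

definition unital_ideal :: "'a::ring set \<Rightarrow> bool" where
  "unital_ideal I \<longleftrightarrow>
     (\<exists>u. u * u = u \<and> (\<forall>a. u * a = a * u) \<and> I = range (\<lambda>a. u * a))"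

definition ring_iso_betw :: "('a::ring \<Rightarrow> 'a) \<Rightarrow> 'a set \<Rightarrow> 'a set \<Rightarrow> bool" where
  "ring_iso_betw f I J \<longleftrightarrow>
     bij_betw f I J \<and>
     (\<forall>x\<in>I. \<forall>y\<in>I. f (x + y) = f x + f y) \<and>
     (\<forall>x\<in>I. \<forall>y\<in>I. f (x * y) = f x * f y)"

definition ideal_sum :: "('i \<Rightarrow> 'a::ring set) \<Rightarrow> 'i set \<Rightarrow> 'a set" where
  "ideal_sum A T =
     {\<Sum>t\<in>F. x t | F x. finite F \<and> F \<subseteq> T \<and> (\<forall>t\<in>F. x t \<in> A t)}"


section \<open>Actions of inverse semigroups\<close>

text \<open>A partial map is represented by a total function together with its domain; values
  outside the domain are irrelevant. In particular, the map \<open>\<beta>\<^sub>s\<close> is \<open>\<beta> s\<close> on \<open>A (sinv s)\<close>.\<close>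

locale inverse_semigroup_action = assoc_algebra scale
  for scale :: "'k::comm_ring_1 \<Rightarrow> 'a::ring \<Rightarrow> 'a" +
  fixes A :: "'s::inverse_semigroup \<Rightarrow> 'a set"
    and \<beta> :: "'s \<Rightarrow> 'a \<Rightarrow> 'a"
  assumes ideal: "ring_ideal (A s)"
    and submodule: "subspace (A s)"
    and iso: "ring_iso_betw (\<beta> s) (A (sinv s)) (A s)"
    and linear: "x \<in> A (sinv s) \<Longrightarrow> \<beta> s (scale c x) = scale c (\<beta> s x)"
    and covering: "ideal_sum A idems = UNIV"
    and domain_comp: "A (sinv (s * t)) = {a \<in> A (sinv t). \<beta> t a \<in> A t \<inter> A (sinv s)}"
    and comp: "a \<in> A (sinv (s * t)) \<Longrightarrow> \<beta> s (\<beta> t a) = \<beta> (s * t) a"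

locale unital_inverse_semigroup_action = inverse_semigroup_action scale A \<beta>
  for scale :: "'k::comm_ring_1 \<Rightarrow> 'a::ring \<Rightarrow> 'a"
    and A :: "'s::inverse_semigroup \<Rightarrow> 'a set"
    and \<beta> :: "'s \<Rightarrow> 'a \<Rightarrow> 'a" +
  assumes unital: "unital_ideal (A s)"

text \<open>Injectivity refers to equality of the \<open>\<beta>\<^sub>s\<close> as maps \<open>A (sinv s) \<rightarrow> A s\<close>.\<close>

definition injective_action ::
    "('s::inverse_semigroup \<Rightarrow> 'a::ring set) \<Rightarrow> ('s \<Rightarrow> 'a \<Rightarrow> 'a) \<Rightarrow> bool" where
  "injective_action A \<beta> \<longleftrightarrow>
     (\<forall>s t. A (sinv s) = A (sinv t) \<and> A s = A t \<and> (\<forall>x\<in>A (sinv s). \<beta> s x = \<beta> t x) \<longrightarrow> s = t)"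

text \<open>The map \<open>\<Sum>\<^bsub>t\<in>C\<^esub> \<beta>\<^sub>t\<close>, sending \<open>\<Sum>\<^sub>t x\<^sub>t\<close> with \<open>x\<^sub>t \<in> A (sinv t)\<close> to \<open>\<Sum>\<^sub>t \<beta>\<^sub>t x\<^sub>t\<close>; the description
  is meaningful when the result does not depend on the chosen decomposition.\<close>

definition sum_of_maps ::
    "('s::inverse_semigroup \<Rightarrow> 'a::ring set) \<Rightarrow> ('s \<Rightarrow> 'a \<Rightarrow> 'a) \<Rightarrow> 's set \<Rightarrow> 'a \<Rightarrow> 'a" where
  "sum_of_maps A \<beta> C a =
     (THE b. \<exists>F x. finite F \<and> F \<subseteq> C \<and> (\<forall>t\<in>F. x t \<in> A (sinv t)) \<and>
        a = (\<Sum>t\<in>F. x t) \<and> b = (\<Sum>t\<in>F. \<beta> t (x t)))"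


section \<open>Partial actions of groups\<close>

locale partial_action = group G
  for G :: "('g, 'm) monoid_scheme" (structure) +
  fixes D :: "'g \<Rightarrow> 'a::ring set"
    and \<alpha> :: "'g \<Rightarrow> 'a \<Rightarrow> 'a"
  assumes ideal: "g \<in> carrier G \<Longrightarrow> ring_ideal (D g)"
    and iso: "g \<in> carrier G \<Longrightarrow> ring_iso_betw (\<alpha> g) (D (inv g)) (D g)"
    and P1: "D \<one> = UNIV" "\<alpha> \<one> x = x"
    and P2: "\<lbrakk>g \<in> carrier G; h \<in> carrier G\<rbrakk> \<Longrightarrow>
        {x \<in> D (inv h). \<alpha> h x \<in> D (inv g) \<inter> D h} \<subseteq> D (inv (g \<otimes> h))"
    and P3: "\<lbrakk>g \<in> carrier G; h \<in> carrier G; x \<in> D (inv h); \<alpha> h x \<in> D (inv g) \<inter> D h\<rbrakk> \<Longrightarrow>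
        \<alpha> g (\<alpha> h x) = \<alpha> (g \<otimes> h) x"

locale unital_partial_action = partial_action G D \<alpha>
  for G :: "('g, 'm) monoid_scheme" (structure)
    and D :: "'g \<Rightarrow> 'a::ring set"
    and \<alpha> :: "'g \<Rightarrow> 'a \<Rightarrow> 'a" +
  assumes unital: "g \<in> carrier G \<Longrightarrow> unital_ideal (D g)"

end

theory Submission
  imports Defs
begin

text \<open>
  In an \<open>E\<close>-unitary inverse semigroup, \<open>\<sigma>\<close>-related elements \<open>s\<close> and \<open>t\<close> have a meet
  \<open>s (sinv t \<cdot> t) = t (sinv s \<cdot> s)\<close> (\<open>E_unitary_sigma_meet\<close>). Restricting \<open>\<beta>\<^sub>s\<close> to \<open>A (sinv t)\<close> gives the
  map of that meet, and so does restricting \<open>\<beta>\<^sub>t\<close> to \<open>A (sinv s)\<close>; hence related maps agree on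
  common domains (\<open>\<beta>_agree\<close>), and so do their inverses.

  The heart of the matter is the resulting product formula \<open>\<beta>\<^sub>s (x y) = \<beta>\<^sub>s x \<cdot> \<beta>\<^sub>t y\<close> for related
  \<open>s, t\<close> and elements \<open>x\<close>, \<open>y\<close> of the two different domains (\<open>\<beta>_mult_related\<close>). It makes the sum of
  the maps in a class well defined: if \<open>\<Sum>\<^sub>t x\<^sub>t = 0\<close>, then \<open>\<beta>\<^sub>s c \<cdot> \<Sum>\<^sub>t \<beta>\<^sub>t x\<^sub>t = \<beta>\<^sub>s (c \<cdot> \<Sum>\<^sub>t x\<^sub>t) = 0\<close> for
  every \<open>s\<close> in the class, so \<open>\<Sum>\<^sub>t \<beta>\<^sub>t x\<^sub>t\<close> is annihilated by every summand \<open>A s\<close> of an ideal that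
  contains it. That ideal is a finite sum of unital ideals and so has a unit, which forces
  \<open>\<Sum>\<^sub>t \<beta>\<^sub>t x\<^sub>t = 0\<close> (\<open>sum_eq_zero_imp\<close>). The same formula makes \<open>\<alpha>\<^sub>g\<close> multiplicative, and its inverse
  is \<open>\<alpha>\<close> of the inverse class.

  The class of the idempotents is exactly \<open>idems\<close> by \<open>E\<close>-unitarity, and each idempotent acts as
  the identity, so the covering condition gives (P1). For (P2) and (P3), an element \<open>y\<close> of
  \<open>D (inv g) \<inter> D h\<close> is multiplied by the unit of \<open>D (inv g)\<close>; this decomposes it into summands in
  \<open>A (sinv s) \<inter> A t\<close> with \<open>s \<in> g\<close> and \<open>t \<in> h\<close>, on which the action law for \<open>s t\<close> applies
  (\<open>\<alpha>_comp\<close>).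
\<close>

section \<open>Inverse semigroups and their maximal group image\<close>

lemma idem_mult_self: "e \<in> idems \<Longrightarrow> e * e = e"
  by (simp add: idems_def)

lemma idem_absorb: "e \<in> idems \<Longrightarrow> e * (e * x) = e * x"
  by (metis idem_mult_self mult.assoc)

lemma sinv_props:
  fixes s :: "'s::inverse_semigroup"
  shows mult_sinv_mult: "s * sinv s * s = s" and sinv_mult_sinv: "sinv s * s * sinv s = sinv s"
  using theI'[OF unique_generalized_inverse[of s]] by (auto simp: sinv_def)

lemma sinv_unique:
  fixes s :: "'s::inverse_semigroup"
  assumes "s * t * s = s" "t * s * t = t"
  shows "sinv s = t"
  using assms sinv_props[of s] unique_generalized_inverse[of s] by blast

lemma sinv_sinv [simp]: "sinv (sinv s) = (s::'s::inverse_semigroup)"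
  by (rule sinv_unique) (simp_all add: sinv_props)

lemma sinv_idem: "e \<in> idems \<Longrightarrow> sinv e = e"
  by (rule sinv_unique) (simp_all add: idem_mult_self)

lemma mult_sinv_idem: "s * sinv s \<in> idems"
  by (simp add: idems_def sinv_mult_sinv flip: mult.assoc) (simp add: sinv_props)

lemma sinv_mult_idem: "sinv s * s \<in> idems"
  by (simp add: idems_def sinv_mult_sinv flip: mult.assoc)

text \<open>With \<open>x\<close> the inverse of \<open>e f\<close>, the element \<open>f x e\<close> is an inverse of \<open>e f\<close> too, and it is visibly
  idempotent. By uniqueness it equals \<open>x\<close>, and an idempotent is its own inverse, so \<open>e f = x\<close>.\<close>

lemma idem_mult_idem:
  fixes e f :: "'s::inverse_semigroup"
  assumes e: "e \<in> idems" and f: "f \<in> idems"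
  shows "e * f \<in> idems"
proof -
  define x where "x = sinv (e * f)"
  have x1: "e * (f * (x * (e * f))) = e * f" and x2: "x * (e * (f * x)) = x"
    using sinv_props[of "e * f"] by (simp_all add: x_def mult.assoc)
  note x2' = arg_cong[OF x2, of "\<lambda>z. z * e"]
  have "sinv (e * f) = f * x * e"
    by (rule sinv_unique)
       (use x1 x2' in \<open>simp_all add: mult.assoc idem_absorb[OF e] idem_absorb[OF f]\<close>)
  then have fxe: "f * (x * e) = x"
    by (simp add: x_def mult.assoc)
  have "x * x = f * (x * e) * (f * (x * e))"
    by (simp add: fxe)
  also have "\<dots> = f * (x * e)"
    using x2' by (simp add: mult.assoc)
  finally have "x \<in> idems"
    by (simp add: idems_def fxe)
  then show ?thesis
    using sinv_idem[of x] by (simp add: x_def)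
qed

text \<open>Once products of idempotents are idempotent, \<open>e f\<close> and \<open>f e\<close> are both inverses of \<open>e f\<close>.\<close>

lemma idem_commute:
  fixes e f :: "'s::inverse_semigroup"
  assumes e: "e \<in> idems" and f: "f \<in> idems"
  shows "e * f = f * e"
proof -
  note ef = idem_mult_self[OF idem_mult_idem[OF e f]] and fe = idem_mult_self[OF idem_mult_idem[OF f e]]
  have "sinv (e * f) = f * e"
    by (rule sinv_unique)
       (use ef fe in \<open>simp_all add: mult.assoc idem_absorb[OF e] idem_absorb[OF f]\<close>)
  then show ?thesis
    by (simp add: sinv_idem idem_mult_idem e f)
qed

lemma sinv_mult: "sinv (s * t) = sinv t * sinv (s::'s::inverse_semigroup)"
proof -
  have c: "t * sinv t * (sinv s * s) = sinv s * s * (t * sinv t)"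
    by (rule idem_commute) (rule mult_sinv_idem sinv_mult_idem)+
  show ?thesis
  proof (rule sinv_unique)
    have "s * t * (sinv t * sinv s) * (s * t) = s * (t * sinv t * (sinv s * s)) * t"
      by (simp add: mult.assoc)
    also have "\<dots> = s * sinv s * s * (t * sinv t * t)"
      unfolding c by (simp add: mult.assoc)
    finally show "s * t * (sinv t * sinv s) * (s * t) = s * t"
      by (simp add: sinv_props)
    have "sinv t * sinv s * (s * t) * (sinv t * sinv s) = sinv t * (sinv s * s * (t * sinv t)) * sinv s"
      by (simp add: mult.assoc)
    also have "\<dots> = sinv t * t * sinv t * (sinv s * s * sinv s)"
      unfolding c[symmetric] by (simp add: mult.assoc)
    finally show "sinv t * sinv s * (s * t) * (sinv t * sinv s) = sinv t * sinv s"
      by (simp add: sinv_props)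
  qed
qed

text \<open>An idempotent moves from the left of \<open>r\<close> to its right at the price of a conjugation, which is
  what makes \<open>\<sigma>\<close> compatible with multiplication on the right.\<close>

lemma idem_mult_swap:
  fixes r :: "'s::inverse_semigroup"
  assumes e: "e \<in> idems"
  shows "r * (sinv r * e * r) = e * r"
proof -
  have "r * (sinv r * e * r) = (r * sinv r * e) * r"
    by (simp add: mult.assoc)
  also have "\<dots> = e * (r * sinv r * r)"
    by (metis idem_commute[OF mult_sinv_idem e] mult.assoc)
  finally show ?thesis
    by (simp add: sinv_props)
qed

lemma conj_idem:
  fixes r :: "'s::inverse_semigroup"
  assumes e: "e \<in> idems"
  shows "sinv r * e * r \<in> idems"
proof -
  have "sinv r * e * r * (sinv r * e * r) = sinv r * e * (r * (sinv r * e * r))"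
    by (simp add: mult.assoc)
  also have "\<dots> = sinv r * e * r"
    unfolding idem_mult_swap[OF e] by (simp add: mult.assoc idem_absorb[OF e])
  finally show ?thesis
    by (simp add: idems_def)
qed

text \<open>A common lower bound \<open>s e = t f\<close> can be cut down by \<open>e f\<close> on both sides, so a single idempotent
  suffices.\<close>

lemma sigma_iff: "(s, t) \<in> sigma \<longleftrightarrow> (\<exists>e\<in>idems. s * e = t * (e::'s::inverse_semigroup))"
proof
  assume "(s, t) \<in> sigma"
  then obtain e f where e: "e \<in> idems" and f: "f \<in> idems" and eq: "s * e = t * f"
    by (auto simp: sigma_def nat_le_def)
  have "s * (e * f) = t * f"
    by (simp add: eq idem_mult_self[OF f] mult.assoc flip: mult.assoc[of s])
  moreover have "t * (e * f) = s * e"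
    by (simp add: idem_commute[OF e f] idem_mult_self[OF e] mult.assoc flip: eq mult.assoc[of t])
  ultimately show "\<exists>e\<in>idems. s * e = t * e"
    using eq idem_mult_idem[OF e f] by metis
qed (auto simp: sigma_def nat_le_def)

lemma equiv_sigma: "equiv UNIV (sigma :: ('s::inverse_semigroup \<times> 's) set)"
proof (rule equivI)
  show "refl (sigma :: ('s \<times> 's) set)"
    using mult_sinv_idem by (auto simp: refl_on_def sigma_iff)
  show "sym (sigma :: ('s \<times> 's) set)"
    by (rule symI) (metis sigma_iff)
  show "trans (sigma :: ('s \<times> 's) set)"
  proof (rule transI)
    fix r s t :: 's
    assume "(r, s) \<in> sigma" "(s, t) \<in> sigma"
    then obtain e f where e: "e \<in> idems" "r * e = s * e" and f: "f \<in> idems" "s * f = t * f"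
      by (auto simp: sigma_iff)
    have "r * (e * f) = s * (f * e)"
      by (metis e f idem_commute mult.assoc)
    also have "\<dots> = t * (e * f)"
      by (metis e f idem_commute mult.assoc)
    finally show "(r, t) \<in> sigma"
      using idem_mult_idem e f sigma_iff by blast
  qed
qed simp

lemma sigma_mult:
  fixes s t :: "'s::inverse_semigroup"
  assumes "(s, s') \<in> sigma" "(t, t') \<in> sigma"
  shows "(s * t, s' * t') \<in> sigma"
proof -
  obtain e where e: "e \<in> idems" "s * e = s' * e"
    using assms by (auto simp: sigma_iff)
  obtain f where f: "f \<in> idems" "t * f = t' * f"
    using assms by (auto simp: sigma_iff)
  have "s * t * (sinv t * e * t) = s' * t * (sinv t * e * t)"
    by (metis e idem_mult_swap mult.assoc)
  then have "(s * t, s' * t) \<in> sigma"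
    using conj_idem[OF e(1)] sigma_iff by blast
  moreover have "(s' * t, s' * t') \<in> sigma"
    by (metis f mult.assoc sigma_iff)
  ultimately show ?thesis
    using equiv_sigma by (meson equivE transD)
qed

lemma sigma_idems:
  fixes e f :: "'s::inverse_semigroup"
  assumes "e \<in> idems" "f \<in> idems"
  shows "(e, f) \<in> sigma"
proof -
  have "e * (e * f) = f * (e * f)"
    by (metis assms idem_absorb idem_commute)
  then show ?thesis
    using sigma_iff idem_mult_idem[OF assms] by blast
qed

lemma sigma_class_eq_iff:
  "sigma `` {s} = sigma `` {t} \<longleftrightarrow> (s, t::'s::inverse_semigroup) \<in> sigma"
  by (simp add: eq_equiv_class_iff[OF equiv_sigma])

lemma max_group_mult:
  "sigma `` {s} \<otimes>\<^bsub>max_group_image\<^esub> sigma `` {t} = sigma `` {s * t::'s::inverse_semigroup}"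
proof -
  have "sigma `` {s' * t'} = sigma `` {s * t}" if "(s, s') \<in> sigma" "(t, t') \<in> sigma" for s' t'
    using sigma_mult[OF that] by (simp add: sigma_class_eq_iff[symmetric])
  then have "(\<Union>s'\<in>sigma `` {s}. \<Union>t'\<in>sigma `` {t}. sigma `` {s' * t'}) =
      (\<Union>s'\<in>sigma `` {s}. \<Union>t'\<in>sigma `` {t}. sigma `` {s * t})"
    by (intro SUP_cong refl) simp_all
  moreover have "s \<in> sigma `` {s}" "t \<in> sigma `` {t}"
    by (simp_all flip: sigma_class_eq_iff)
  then have "sigma `` {s} \<noteq> {}" "sigma `` {t} \<noteq> {}"
    by blast+
  ultimately show ?thesis
    by (simp add: max_group_image_def)
qed

lemma max_group_one:
  assumes "e \<in> idems"
  shows "\<one>\<^bsub>max_group_image\<^esub> = sigma `` {e::'s::inverse_semigroup}"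
proof -
  have "sigma `` {f} = sigma `` {e}" if "f \<in> idems" for f
    using that assms by (simp add: sigma_class_eq_iff sigma_idems)
  then have "(\<Union>f\<in>idems. sigma `` {f}) = (\<Union>f\<in>(idems :: 's set). sigma `` {e})"
    by (intro SUP_cong refl)
  moreover have "(idems :: 's set) \<noteq> {}"
    using assms by blast
  ultimately show ?thesis
    by (simp add: max_group_image_def)
qed

lemma max_group_carrier: "carrier max_group_image = (\<lambda>s. sigma `` {s}) ` UNIV"
  by (auto simp: max_group_image_def quotient_def)

lemma group_max_group_image: "group (max_group_image :: 's::inverse_semigroup set monoid)"
proof (rule groupI)
  obtain e :: 's where e: "e \<in> idems"
    using mult_sinv_idem by blast
  note one = max_group_one[OF e]
  show "\<one>\<^bsub>max_group_image\<^esub> \<in> carrier (max_group_image :: 's set monoid)"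
    unfolding one by (simp add: max_group_carrier)
  fix x :: "'s set" assume x: "x \<in> carrier max_group_image"
  then obtain s where s: "x = sigma `` {s}"
    by (auto simp: max_group_carrier)
  have "(e * s, s) \<in> sigma"
    unfolding sigma_iff
  proof
    show "e * s * (sinv s * e * s) = s * (sinv s * e * s)"
      by (metis e idem_absorb idem_mult_swap mult.assoc)
  qed (rule conj_idem[OF e])
  then show "\<one>\<^bsub>max_group_image\<^esub> \<otimes>\<^bsub>max_group_image\<^esub> x = x"
    by (simp add: one s max_group_mult sigma_class_eq_iff)
  show "\<exists>y\<in>carrier max_group_image. y \<otimes>\<^bsub>max_group_image\<^esub> x = \<one>\<^bsub>max_group_image\<^esub>"
    by (rule bexI[of _ "sigma `` {sinv s}"])
       (simp_all add: s max_group_mult max_group_carrier max_group_one[OF sinv_mult_idem[of s]])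
qed (auto simp: max_group_carrier max_group_mult mult.assoc)

lemma max_group_inv:
  "inv\<^bsub>max_group_image\<^esub> (sigma `` {s}) = sigma `` {sinv s::'s::inverse_semigroup}"
  by (rule group.inv_equality[OF group_max_group_image])
     (simp_all add: max_group_mult max_group_carrier max_group_one[OF sinv_mult_idem[of s]])

lemma sigma_sinv_iff: "(sinv s, sinv t) \<in> sigma \<longleftrightarrow> (s, t::'s::inverse_semigroup) \<in> sigma"
proof -
  have imp: "(sinv s, sinv t) \<in> sigma" if "(s, t) \<in> sigma" for s t :: 's
  proof -
    have "sigma `` {s} = sigma `` {t}"
      using that by (simp add: sigma_class_eq_iff)
    then have "sigma `` {sinv s} = sigma `` {sinv t}"
      by (simp flip: max_group_inv)
    then show ?thesis
      by (simp add: sigma_class_eq_iff)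
  qed
  then show ?thesis
    using imp[of "sinv s" "sinv t"] by auto
qed

lemma max_group_inv_eq_image:
  fixes g :: "'s::inverse_semigroup set"
  assumes "g \<in> carrier max_group_image"
  shows "inv\<^bsub>max_group_image\<^esub> g = sinv ` g"
proof -
  obtain s where s: "g = sigma `` {s}"
    using assms by (auto simp: max_group_carrier)
  have "t \<in> inv\<^bsub>max_group_image\<^esub> g \<longleftrightarrow> sinv t \<in> g" for t
    using sigma_sinv_iff[of s "sinv t"] by (simp add: s max_group_inv)
  moreover have "t \<in> sinv ` g \<longleftrightarrow> sinv t \<in> g" for t
    by (metis image_iff sinv_sinv)
  ultimately show ?thesis
    by blast
qed

lemma max_group_class_sigma:
  assumes "g \<in> carrier max_group_image" "s \<in> g" "t \<in> g"
  shows "(s, t) \<in> sigma"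
proof -
  obtain r where "g = sigma `` {r}"
    using assms by (auto simp: max_group_carrier)
  then show ?thesis
    using assms by (auto simp flip: sigma_class_eq_iff)
qed

lemma max_group_mult_mem:
  fixes g h :: "'s::inverse_semigroup set"
  assumes "g \<in> carrier max_group_image" "h \<in> carrier max_group_image" "s \<in> g" "t \<in> h"
  shows "s * t \<in> g \<otimes>\<^bsub>max_group_image\<^esub> h"
proof -
  obtain s' t' where "g = sigma `` {s'}" "h = sigma `` {t'}"
    using assms by (auto simp: max_group_carrier)
  then show ?thesis
    using assms sigma_mult by (auto simp: max_group_mult)
qed

lemma E_unitary_sigma_idem:
  fixes e s :: "'s::E_unitary_inverse_semigroup"
  assumes "(e, s) \<in> sigma" and e: "e \<in> idems"
  shows "s \<in> idems"
proof -
  obtain f where f: "f \<in> idems" "e * f = s * f"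
    using assms by (auto simp: sigma_iff)
  then have "e * f \<preceq> s"
    by (auto simp: nat_le_def)
  then show ?thesis
    using E_unitary idem_mult_idem e f by blast
qed

lemma E_unitary_max_group_one:
  "\<one>\<^bsub>max_group_image\<^esub> = (idems :: 's::E_unitary_inverse_semigroup set)"
proof -
  obtain e :: 's where e: "e \<in> idems"
    using mult_sinv_idem by blast
  then show ?thesis
    using E_unitary_sigma_idem sigma_idems by (auto simp: max_group_one[OF e])
qed

text \<open>Here \<open>e = s \<cdot> sinv t\<close> is idempotent by \<open>E\<close>-unitarity, so the left-hand side \<open>e t\<close> lies below
  \<open>t\<close>. An element \<open>u\<close> below \<open>t\<close> equals \<open>t (sinv u \<cdot> u)\<close>, and for \<open>u = e t\<close> the idempotent
  \<open>sinv u \<cdot> u\<close> is the product of \<open>sinv t \<cdot> t\<close> and \<open>sinv s \<cdot> s\<close>.\<close>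

lemma E_unitary_sigma_meet:
  fixes s t :: "'s::E_unitary_inverse_semigroup"
  assumes "(s, t) \<in> sigma"
  shows "s * (sinv t * t) = t * (sinv s * s)"
proof -
  define e where "e = s * sinv t"
  have "(t * sinv t, e) \<in> sigma"
    using assms equiv_sigma unfolding e_def
    by (metis sigma_class_eq_iff sigma_mult)
  then have e: "e \<in> idems"
    by (rule E_unitary_sigma_idem) (rule mult_sinv_idem)
  have et: "s * (sinv t * t) = e * t"
    by (simp add: e_def mult.assoc)
  have "sinv t * e * t = sinv (e * t) * (e * t)"
    by (simp add: sinv_mult sinv_idem[OF e] idem_absorb[OF e] mult.assoc)
  also have "\<dots> = sinv t * t * (sinv s * s) * (sinv t * t)"
    by (simp add: sinv_mult mult.assoc flip: et)
  also have "\<dots> = (sinv s * s) * (sinv t * t) * (sinv t * t)"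
    by (metis idem_commute sinv_mult_idem)
  also have "\<dots> = (sinv t * t) * (sinv s * s)"
    by (metis idem_commute idem_mult_self sinv_mult_idem mult.assoc)
  finally have "t * (sinv t * e * t) = t * sinv t * t * (sinv s * s)"
    by (simp add: mult.assoc)
  then show ?thesis
    by (simp add: et sinv_props idem_mult_swap[OF e])
qed

section \<open>Finite sums of unital ideals\<close>

lemma ring_ideal_zero: "ring_ideal I \<Longrightarrow> 0 \<in> I"
  and ring_ideal_add: "ring_ideal I \<Longrightarrow> x \<in> I \<Longrightarrow> y \<in> I \<Longrightarrow> x + y \<in> I"
  and ring_ideal_uminus: "ring_ideal I \<Longrightarrow> x \<in> I \<Longrightarrow> - x \<in> I"
  and ring_ideal_mult_left: "ring_ideal I \<Longrightarrow> x \<in> I \<Longrightarrow> a * x \<in> I"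
  and ring_ideal_mult_right: "ring_ideal I \<Longrightarrow> x \<in> I \<Longrightarrow> x * a \<in> I"
  by (simp_all add: ring_ideal_def)

lemma ring_ideal_sum:
  assumes "ring_ideal I" "\<And>i. i \<in> J \<Longrightarrow> x i \<in> I"
  shows "sum x J \<in> I"
  using assms(2)
  by (induction J rule: infinite_finite_induct) (simp_all add: ring_ideal_zero ring_ideal_add assms(1))

text \<open>Padding a family by zeros allows the full index set to be used, so that two decompositions
  can be added or compared termwise.\<close>

lemma ideal_sum_finite:
  assumes "finite T" and "\<And>t. ring_ideal (A t)"
  shows "ideal_sum A T = {\<Sum>t\<in>T. x t | x. \<forall>t\<in>T. x t \<in> A t}"
proof (intro equalityI subsetI)
  fix a assume "a \<in> ideal_sum A T"
  then obtain F x where F: "F \<subseteq> T" "\<forall>t\<in>F. x t \<in> A t" "a = sum x F"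
    by (auto simp: ideal_sum_def)
  define y where "y t = (if t \<in> F then x t else 0)" for t
  have "a = sum y T"
    unfolding F(3) y_def using F(1) assms(1) by (simp add: sum.If_cases Int_absorb1)
  moreover have "\<forall>t\<in>T. y t \<in> A t"
    using F(2) assms(2) by (simp add: y_def ring_ideal_zero)
  ultimately show "a \<in> {\<Sum>t\<in>T. x t | x. \<forall>t\<in>T. x t \<in> A t}"
    by blast
qed (use assms(1) in \<open>auto simp: ideal_sum_def\<close>)

lemma ideal_sum_summand:
  assumes "t \<in> T" "x \<in> A t"
  shows "x \<in> ideal_sum A T"
proof -
  have "x = (\<Sum>i\<in>{t}. x)"
    by simp
  moreover have "finite {t}" "{t} \<subseteq> T" "\<forall>i\<in>{t}. x \<in> A i"
    using assms by auto
  ultimately show ?thesis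
    unfolding ideal_sum_def by blast
qed

lemma ring_ideal_ideal_sum:
  assumes T: "finite T" and A: "\<And>t. ring_ideal (A t)"
  shows "ring_ideal (ideal_sum A T)"
  unfolding ring_ideal_def ideal_sum_finite[OF assms]
proof safe
  show "\<exists>x. 0 = sum x T \<and> (\<forall>t\<in>T. x t \<in> A t)"
    by (rule exI[of _ "\<lambda>_. 0"]) (simp add: A ring_ideal_zero)
  fix x assume x: "\<forall>t\<in>T. x t \<in> A t"
  show "\<exists>y. - sum x T = sum y T \<and> (\<forall>t\<in>T. y t \<in> A t)"
    by (rule exI[of _ "\<lambda>t. - x t"]) (simp add: A x ring_ideal_uminus sum_negf)
  show "\<exists>z. a * sum x T = sum z T \<and> (\<forall>t\<in>T. z t \<in> A t)" for a
    by (rule exI[of _ "\<lambda>t. a * x t"]) (simp add: A x ring_ideal_mult_left sum_distrib_left)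
  show "\<exists>z. sum x T * a = sum z T \<and> (\<forall>t\<in>T. z t \<in> A t)" for a
    by (rule exI[of _ "\<lambda>t. x t * a"]) (simp add: A x ring_ideal_mult_right sum_distrib_right)
  fix y assume y: "\<forall>t\<in>T. y t \<in> A t"
  show "\<exists>z. sum x T + sum y T = sum z T \<and> (\<forall>t\<in>T. z t \<in> A t)"
    by (rule exI[of _ "\<lambda>t. x t + y t"]) (simp add: A x y ring_ideal_add sum.distrib)
qed

lemma unital_ideal_unit:
  assumes "unital_ideal I"
  obtains p where "p \<in> I" "\<And>a. p * a = a * p" "\<And>x. x \<in> I \<Longrightarrow> p * x = x"
proof -
  obtain p where p: "p * p = p" "\<And>a. p * a = a * p" "I = range (\<lambda>a. p * a)"
    using assms unfolding unital_ideal_def by blast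
  have "p \<in> I"
    unfolding p(3) by (metis p(1) rangeI)
  moreover have "p * x = x" if "x \<in> I" for x
    using that p(1) unfolding p(3) by (metis imageE mult.assoc)
  ultimately show ?thesis
    using p(2) that by blast
qed

text \<open>By induction on the index set: if \<open>u\<close> and \<open>p\<close> are central units of two ideals, then
  \<open>u + p - u p\<close> is one of their sum. As the ring may lack a unit, this replaces the formula
  \<open>1 - (1 - u) (1 - p)\<close>.\<close>

lemma unital_ideal_sum_unit:
  assumes T: "finite T" and A: "\<And>t. ring_ideal (A t)" and U: "\<And>t. unital_ideal (A t)"
  obtains u where "u \<in> ideal_sum A T" "\<And>a. u * a = a * u" "\<And>x. x \<in> ideal_sum A T \<Longrightarrow> u * x = x"
proof -
  have "\<exists>u\<in>ideal_sum A T. (\<forall>a. u * a = a * u) \<and> (\<forall>t\<in>T. \<forall>x\<in>A t. u * x = x)"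
    using T
  proof (induction T)
    case empty
    then show ?case
      by (auto intro!: bexI[of _ 0] simp: ideal_sum_def)
  next
    case (insert r T)
    then obtain u where u: "u \<in> ideal_sum A T" "\<And>a. u * a = a * u" "\<And>t x. t \<in> T \<Longrightarrow> x \<in> A t \<Longrightarrow> u * x = x"
      by blast
    obtain p where p: "p \<in> A r" "\<And>a. p * a = a * p" "\<And>x. x \<in> A r \<Longrightarrow> p * x = x"
      using unital_ideal_unit[OF U[of r]] by metis
    let ?v = "u + (p + - (u * p))"
    have I: "ring_ideal (ideal_sum A (insert r T))"
      using ring_ideal_ideal_sum insert.hyps A by blast
    have "u \<in> ideal_sum A (insert r T)"
      using u(1) by (fastforce simp: ideal_sum_def)
    moreover have "p \<in> ideal_sum A (insert r T)"
      by (rule ideal_sum_summand[where A = A and t = r]) (simp_all add: p(1))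
    ultimately have "?v \<in> ideal_sum A (insert r T)"
      by (intro ring_ideal_add[OF I] ring_ideal_uminus[OF I] ring_ideal_mult_left[OF I])
    moreover have "?v * a = a * ?v" for a
    proof -
      have upa: "u * (p * a) = a * (u * p)"
        by (metis p(2) u(2) mult.assoc)
      have "?v * a = u * a + (p * a - u * (p * a))"
        by (simp add: algebra_simps)
      also have "\<dots> = a * u + (a * p - a * (u * p))"
        by (subst upa) (simp only: u(2)[of a] p(2)[of a])
      finally show ?thesis
        by (simp add: algebra_simps)
    qed
    moreover have "?v * x = x" if "t \<in> insert r T" "x \<in> A t" for t x
    proof (cases "t \<in> T")
      case True
      have "u * (p * x) = p * x"
        using u(3)[OF True, of "p * x"] A that ring_ideal_mult_left by blast
      then show ?thesis
        using u(3)[OF True] that by (simp add: algebra_simps)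
    next
      case False
      then have "p * x = x"
        using that p(3) by blast
      then show ?thesis
        by (simp add: algebra_simps)
    qed
    ultimately show ?case
      by blast
  qed
  then obtain u where u: "u \<in> ideal_sum A T" "\<And>a. u * a = a * u"
      "\<And>t x. t \<in> T \<Longrightarrow> x \<in> A t \<Longrightarrow> u * x = x"
    by blast
  have "u * x = x" if "x \<in> ideal_sum A T" for x
  proof -
    have "x \<in> {\<Sum>t\<in>T. y t | y. \<forall>t\<in>T. y t \<in> A t}"
      using that ideal_sum_finite[of T A] T A by simp
    then obtain y where y: "x = sum y T" "\<And>t. t \<in> T \<Longrightarrow> y t \<in> A t"
      by blast
    then show ?thesis
      by (simp add: sum_distrib_left u(3))
  qed
  then show ?thesis
    using u that by blast
qed

lemma unital_ideal_sum:
  assumes T: "finite T" and A: "\<And>t. ring_ideal (A t)" and U: "\<And>t. unital_ideal (A t)"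
  shows "unital_ideal (ideal_sum A T)"
proof -
  obtain u where u: "u \<in> ideal_sum A T" "\<And>a. u * a = a * u" "\<And>x. x \<in> ideal_sum A T \<Longrightarrow> u * x = x"
    by (rule unital_ideal_sum_unit[where A = A and T = T]) (use assms in blast)+
  have "ideal_sum A T = range ((*) u)"
  proof (intro equalityI subsetI)
    show "x \<in> range ((*) u)" if "x \<in> ideal_sum A T" for x
      using u(3)[OF that] by (metis rangeI)
    show "x \<in> ideal_sum A T" if "x \<in> range ((*) u)" for x
      using that ring_ideal_mult_right[OF ring_ideal_ideal_sum[of T A] u(1)] T A by auto
  qed
  moreover have "u * u = u"
    using u(1,3) by blast
  ultimately show ?thesis
    using u(2) unfolding unital_ideal_def by blast
qed

lemma ring_iso_betw_add:
  assumes "ring_iso_betw f I J" "x \<in> I" "y \<in> I"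
  shows "f (x + y) = f x + f y"
  using assms by (simp add: ring_iso_betw_def)

lemma ring_iso_betw_mult:
  assumes "ring_iso_betw f I J" "x \<in> I" "y \<in> I"
  shows "f (x * y) = f x * f y"
  using assms by (simp add: ring_iso_betw_def)

lemma ring_iso_betw_mem:
  assumes "ring_iso_betw f I J" "x \<in> I"
  shows "f x \<in> J"
  using assms by (auto simp: ring_iso_betw_def bij_betw_def)

lemma additive_on_zero:
  fixes f :: "'a::ring \<Rightarrow> 'a"
  assumes "\<And>x y. x \<in> I \<Longrightarrow> y \<in> I \<Longrightarrow> f (x + y) = f x + f y" "ring_ideal I"
  shows "f 0 = 0"
  using assms(1)[of 0 0] ring_ideal_zero[OF assms(2)] by simp

lemma additive_on_sum:
  fixes f :: "'a::ring \<Rightarrow> 'a"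
  assumes add: "\<And>x y. x \<in> I \<Longrightarrow> y \<in> I \<Longrightarrow> f (x + y) = f x + f y" and I: "ring_ideal I"
    and x: "\<And>j. j \<in> J \<Longrightarrow> x j \<in> I"
  shows "f (sum x J) = (\<Sum>j\<in>J. f (x j))"
proof -
  have zero: "f 0 = 0"
    by (rule additive_on_zero[of I]) (use add I in auto)
  show ?thesis
    using x
  proof (induction J rule: infinite_finite_induct)
    case (insert i J)
    have "f (x i + sum x J) = f (x i) + f (sum x J)"
      by (rule add) (use insert.prems in \<open>simp_all add: ring_ideal_sum[OF I]\<close>)
    then show ?case
      using insert by simp
  qed (simp_all add: zero)
qed

section \<open>Compatibility of related maps\<close>

context inverse_semigroup_action
begin

lemma \<beta>_mem: "x \<in> A (sinv s) \<Longrightarrow> \<beta> s x \<in> A s"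
  by (rule ring_iso_betw_mem[OF iso])

lemma \<beta>_add: "x \<in> A (sinv s) \<Longrightarrow> y \<in> A (sinv s) \<Longrightarrow> \<beta> s (x + y) = \<beta> s x + \<beta> s y"
  by (rule ring_iso_betw_add[OF iso])

lemma \<beta>_mult: "x \<in> A (sinv s) \<Longrightarrow> y \<in> A (sinv s) \<Longrightarrow> \<beta> s (x * y) = \<beta> s x * \<beta> s y"
  by (rule ring_iso_betw_mult[OF iso])

lemma \<beta>_zero: "\<beta> s 0 = 0"
  using \<beta>_add[of 0 s 0] ring_ideal_zero[OF ideal] by simp

text \<open>The domain of \<open>\<beta>\<^sub>s\<close> depends on \<open>s\<close> only through the idempotent \<open>sinv s \<cdot> s\<close>, so restrictions of
  \<open>\<beta>\<^sub>s\<close> to another domain can be expressed by multiplying \<open>s\<close> by an idempotent.\<close>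

lemma A_idem: "A (sinv s * s) = A (sinv s)"
proof -
  have "A (sinv s * s) = {a \<in> A (sinv s). \<beta> s a \<in> A s}"
    using domain_comp[of "sinv s" s] by (simp add: sinv_mult)
  then show ?thesis
    using \<beta>_mem by blast
qed

text \<open>The action law makes \<open>\<beta>\<^sub>e\<close> an idempotent map, and an injective idempotent map is the identity.\<close>

lemma \<beta>_idem:
  assumes e: "e \<in> idems" and x: "x \<in> A e"
  shows "\<beta> e x = x"
proof -
  have "\<beta> e (\<beta> e x) = \<beta> e x"
    using comp[of x e e] x by (simp add: idem_mult_self[OF e] sinv_idem[OF e])
  moreover have "inj_on (\<beta> e) (A e)" "\<beta> e x \<in> A e"
    using iso[of e] \<beta>_mem[of x e] x by (simp_all add: ring_iso_betw_def bij_betw_def sinv_idem[OF e])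
  ultimately show ?thesis
    using x by (simp add: inj_on_eq_iff)
qed

lemma \<beta>_sinv:
  assumes "x \<in> A (sinv s)"
  shows "\<beta> (sinv s) (\<beta> s x) = x"
  using comp[of x "sinv s" s] assms \<beta>_idem[OF sinv_mult_idem] by (simp add: sinv_mult A_idem)

lemma \<beta>_mult_idem:
  assumes e: "e \<in> idems" and x: "x \<in> A e" "x \<in> A (sinv s)"
  shows "\<beta> (s * e) x = \<beta> s x"
proof -
  have "x \<in> A (sinv (s * e))"
    using x by (simp add: domain_comp sinv_idem[OF e] \<beta>_idem[OF e])
  then show ?thesis
    using comp[of x s e] by (simp add: \<beta>_idem[OF e] x)
qed

end

locale E_unitary_unital_action = unital_inverse_semigroup_action scale A \<beta>
  for scale :: "'k::comm_ring_1 \<Rightarrow> 'a::ring \<Rightarrow> 'a"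
    and A :: "'s::E_unitary_inverse_semigroup \<Rightarrow> 'a set"
    and \<beta> :: "'s \<Rightarrow> 'a \<Rightarrow> 'a"
begin

text \<open>Both sides are the value at \<open>x\<close> of the map belonging to the meet of \<open>s\<close> and \<open>t\<close>.\<close>

lemma \<beta>_agree:
  assumes "(s, t) \<in> sigma" and x: "x \<in> A (sinv s)" "x \<in> A (sinv t)"
  shows "\<beta> s x = \<beta> t x"
proof -
  have "\<beta> s x = \<beta> (s * (sinv t * t)) x"
    by (rule \<beta>_mult_idem[symmetric]) (simp_all add: sinv_mult_idem A_idem x)
  also have "\<dots> = \<beta> (t * (sinv s * s)) x"
    by (simp add: E_unitary_sigma_meet[OF assms(1)])
  also have "\<dots> = \<beta> t x"
    by (rule \<beta>_mult_idem) (simp_all add: sinv_mult_idem A_idem x)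
  finally show ?thesis .
qed

text \<open>The two factors on the right lie in different ideals, so multiplicativity of a single map does
  not apply directly. Because \<open>\<beta>\<^sub>s\<close> and \<open>\<beta>\<^sub>t\<close>, and their inverses, agree on intersections, \<open>\<beta>\<^sub>t\<close>
  maps \<open>A (sinv s) \<inter> A (sinv t)\<close> onto \<open>A s \<inter> A t\<close> and hence the unit \<open>r\<close> of the former to the unit
  \<open>w\<close> of the latter. The product on the right lies in \<open>A s \<inter> A t\<close>, so \<open>w = \<beta>\<^sub>t r\<close> may be inserted
  in front of \<open>\<beta>\<^sub>t y\<close>; then \<open>r y\<close> lies in both domains, and only \<open>\<beta>\<^sub>s\<close> is left.\<close>

lemma \<beta>_mult_related:
  assumes st: "(s, t) \<in> sigma" and x: "x \<in> A (sinv s)" and y: "y \<in> A (sinv t)"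
  shows "\<beta> s (x * y) = \<beta> s x * \<beta> t y"
proof -
  have "\<exists>p\<in>A r. (\<forall>a. p * a = a * p) \<and> (\<forall>a\<in>A r. p * a = a)" for r
    by (rule unital_ideal_unit[OF unital[of r]]) blast
  then obtain p where p: "\<And>r. p r \<in> A r" "\<And>r a. p r * a = a * p r" "\<And>r a. a \<in> A r \<Longrightarrow> p r * a = a"
    by metis
  define r where "r = p (sinv s) * p (sinv t)"
  define w where "w = p s * p t"
  have r: "r \<in> A (sinv s)" "r \<in> A (sinv t)"
    unfolding r_def by (simp_all add: p(1) ring_ideal_mult_left[OF ideal] ring_ideal_mult_right[OF ideal])
  have w: "w \<in> A s" "w \<in> A t"
    unfolding w_def by (simp_all add: p(1) ring_ideal_mult_left[OF ideal] ring_ideal_mult_right[OF ideal])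
  have r_unit: "r * a = a" if "a \<in> A (sinv s)" "a \<in> A (sinv t)" for a
    by (simp add: r_def p(3) that mult.assoc)
  have w_unit: "w * a = a" if "a \<in> A s" "a \<in> A t" for a
    by (simp add: w_def p(3) that mult.assoc)
  have r_comm: "r * a = a * r" for a
    unfolding r_def by (metis p(2) mult.assoc)
  \<comment> \<open>The preimage of \<open>w\<close>; it lies in both domains because the inverse maps agree on \<open>w\<close>.\<close>
  define c where "c = \<beta> (sinv t) w"
  have c_s: "c = \<beta> (sinv s) w"
    unfolding c_def using \<beta>_agree[of "sinv s" "sinv t" w] st w by (simp add: sigma_sinv_iff)
  have c: "c \<in> A (sinv s)" "c \<in> A (sinv t)"
    using \<beta>_mem[of w "sinv s"] \<beta>_mem[of w "sinv t"] w by (simp_all add: c_def flip: c_s)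
  have \<beta>c: "\<beta> t c = w"
    using \<beta>_sinv[of w "sinv t"] w by (simp add: c_def)
  have \<beta>r: "\<beta> t r = w"
  proof -
    have "\<beta> t r \<in> A s" "\<beta> t r \<in> A t"
      using \<beta>_mem[of r s] \<beta>_mem[of r t] r \<beta>_agree[OF st] by simp_all
    then have "\<beta> t r = \<beta> t c * \<beta> t r"
      by (simp add: w_unit \<beta>c)
    also have "\<dots> = \<beta> t (r * c)"
      by (simp add: \<beta>_mult r c r_comm[of c])
    finally show ?thesis
      by (simp add: r_unit c \<beta>c)
  qed
  have "\<beta> s x * \<beta> t y = w * (\<beta> s x * \<beta> t y)"
    by (rule w_unit[symmetric])
       (simp_all add: \<beta>_mem x y ring_ideal_mult_left[OF ideal] ring_ideal_mult_right[OF ideal])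
  also have "\<dots> = \<beta> s x * (w * \<beta> t y)"
    unfolding w_def by (metis p(2) mult.assoc)
  also have "w * \<beta> t y = \<beta> t (r * y)"
    by (simp add: \<beta>r \<beta>_mult r y)
  also have "\<beta> t (r * y) = \<beta> s (r * y)"
    by (rule \<beta>_agree[OF st, symmetric]) (simp_all add: r ring_ideal_mult_right[OF ideal])
  also have "\<beta> s x * \<dots> = \<beta> s (x * (r * y))"
    by (simp add: \<beta>_mult x r ring_ideal_mult_right[OF ideal])
  also have "x * (r * y) = r * (x * y)"
    by (metis r_comm mult.assoc)
  also have "r * (x * y) = x * y"
    by (simp add: r_unit x y ring_ideal_mult_left[OF ideal] ring_ideal_mult_right[OF ideal])
  finally show ?thesis ..
qed

end

section \<open>The glued maps form a partial action\<close>

locale finite_E_unitary_unital_action = E_unitary_unital_action scale A \<beta>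
  for scale :: "'k::comm_ring_1 \<Rightarrow> 'a::ring \<Rightarrow> 'a"
    and A :: "'s::{E_unitary_inverse_semigroup, finite} \<Rightarrow> 'a set"
    and \<beta> :: "'s \<Rightarrow> 'a \<Rightarrow> 'a"
begin

abbreviation G :: "'s set monoid" where "G \<equiv> max_group_image"
abbreviation D :: "'s set \<Rightarrow> 'a set" where "D \<equiv> ideal_sum A"
abbreviation \<alpha> :: "'s set \<Rightarrow> 'a \<Rightarrow> 'a" where "\<alpha> \<equiv> sum_of_maps A \<beta>"

lemma D_ideal: "ring_ideal (D g)"
  by (rule ring_ideal_ideal_sum) (simp_all add: ideal)

lemma D_summand: "t \<in> g \<Longrightarrow> x \<in> A t \<Longrightarrow> x \<in> D g"
  by (rule ideal_sum_summand[where A = A])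

text \<open>The inverse class consists of the inverses, so the domain of \<open>\<alpha>\<^sub>g\<close> can be indexed by \<open>g\<close> itself.\<close>

lemma D_inv:
  assumes "g \<in> carrier G"
  shows "D (inv\<^bsub>G\<^esub> g) = {\<Sum>t\<in>g. x t | x. \<forall>t\<in>g. x t \<in> A (sinv t)}"
proof -
  have inj: "inj_on sinv g"
    by (metis inj_onI sinv_sinv)
  have "D (inv\<^bsub>G\<^esub> g) = {\<Sum>t\<in>sinv ` g. x t | x. \<forall>t\<in>sinv ` g. x t \<in> A t}"
    by (simp add: max_group_inv_eq_image[OF assms] ideal_sum_finite ideal)
  also have "\<dots> = {\<Sum>t\<in>g. x t | x. \<forall>t\<in>g. x t \<in> A (sinv t)}"
  proof (intro equalityI subsetI; clarify)
    fix x assume "\<forall>t\<in>sinv ` g. x t \<in> A t"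
    then show "\<exists>y. sum x (sinv ` g) = sum y g \<and> (\<forall>t\<in>g. y t \<in> A (sinv t))"
      by (intro exI[of _ "\<lambda>t. x (sinv t)"]) (simp add: sum.reindex[OF inj])
  next
    fix x assume "\<forall>t\<in>g. x t \<in> A (sinv t)"
    then show "\<exists>y. sum x g = sum y (sinv ` g) \<and> (\<forall>t\<in>sinv ` g. y t \<in> A t)"
      by (intro exI[of _ "\<lambda>t. x (sinv t)"]) (simp add: sum.reindex[OF inj])
  qed
  finally show ?thesis .
qed

lemma D_inv_summand:
  assumes "g \<in> carrier G" "t \<in> g" "x \<in> A (sinv t)"
  shows "x \<in> D (inv\<^bsub>G\<^esub> g)"
  by (rule D_summand[where t = "sinv t"]) (simp_all add: max_group_inv_eq_image assms)

text \<open>This is the well-definedness of the sum of the maps \<open>\<beta>\<^sub>t\<close>: the image sum \<open>z\<close> is annihilated by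
  every \<open>A s\<close> with \<open>s \<in> g\<close>, by the product formula for related maps. The unit of \<open>D g\<close> is a sum of
  elements of these ideals, and it fixes \<open>z\<close>.\<close>

lemma sum_eq_zero_imp:
  assumes g: "g \<in> carrier G" and F: "F \<subseteq> g" and x: "\<And>t. t \<in> F \<Longrightarrow> x t \<in> A (sinv t)"
    and "sum x F = 0"
  shows "(\<Sum>t\<in>F. \<beta> t (x t)) = 0" (is "?z = 0")
proof -
  have annihilated: "b * ?z = 0" if s: "s \<in> g" and b: "b \<in> A s" for s b
  proof -
    define c where "c = \<beta> (sinv s) b"
    have c: "c \<in> A (sinv s)"
      using \<beta>_mem[of b "sinv s"] b by (simp add: c_def)
    have "b = \<beta> s c"
      using \<beta>_sinv[of b "sinv s"] b by (simp add: c_def)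
    then have "b * ?z = (\<Sum>t\<in>F. \<beta> s c * \<beta> t (x t))"
      by (simp add: sum_distrib_left)
    also have "\<dots> = (\<Sum>t\<in>F. \<beta> s (c * x t))"
      using F x c max_group_class_sigma[OF g s] by (auto intro!: sum.cong \<beta>_mult_related[symmetric])
    also have "\<dots> = \<beta> s (\<Sum>t\<in>F. c * x t)"
      by (rule additive_on_sum[where f = "\<beta> s" and I = "A (sinv s)", symmetric])
         (simp_all add: \<beta>_add ideal c ring_ideal_mult_right[OF ideal])
    finally show ?thesis
      by (simp add: assms(4) \<beta>_zero flip: sum_distrib_left)
  qed
  obtain u where u: "u \<in> D g" "\<And>z. z \<in> D g \<Longrightarrow> u * z = z"
    by (rule unital_ideal_sum_unit[where A = A and T = g]) (use ideal unital in simp_all)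
  have "?z \<in> D g"
    using F x by (intro ring_ideal_sum[OF D_ideal]) (blast intro: D_summand \<beta>_mem)
  then have "?z = u * ?z"
    by (simp add: u)
  also have "\<dots> = 0"
    using u(1) by (auto simp: ideal_sum_finite ideal sum_distrib_right annihilated)
  finally show ?thesis .
qed

lemma \<alpha>_sum:
  assumes g: "g \<in> carrier G" and x: "\<And>t. t \<in> g \<Longrightarrow> x t \<in> A (sinv t)"
  shows "\<alpha> g (\<Sum>t\<in>g. x t) = (\<Sum>t\<in>g. \<beta> t (x t))"
  unfolding sum_of_maps_def
proof (rule the_equality)
  show "\<exists>F y. finite F \<and> F \<subseteq> g \<and> (\<forall>t\<in>F. y t \<in> A (sinv t)) \<and> sum x g = sum y F \<and>
      (\<Sum>t\<in>g. \<beta> t (x t)) = (\<Sum>t\<in>F. \<beta> t (y t))"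
    using x by (intro exI[of _ g] exI[of _ x]) auto
next
  fix b
  assume "\<exists>F y. finite F \<and> F \<subseteq> g \<and> (\<forall>t\<in>F. y t \<in> A (sinv t)) \<and> sum x g = sum y F \<and>
      b = (\<Sum>t\<in>F. \<beta> t (y t))"
  then obtain F y where F: "F \<subseteq> g" and y: "\<And>t. t \<in> F \<Longrightarrow> y t \<in> A (sinv t)"
      and eq: "sum x g = sum y F" and b: "b = (\<Sum>t\<in>F. \<beta> t (y t))"
    by blast
  define y' where "y' t = (if t \<in> F then y t else 0)" for t
  have y': "y' t \<in> A (sinv t)" for t
    by (simp add: y'_def y ring_ideal_zero[OF ideal])
  have sum_y': "sum y' g = sum y F"
    unfolding y'_def using F by (simp add: sum.If_cases Int_absorb1)
  have b': "b = (\<Sum>t\<in>g. \<beta> t (y' t))"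
    unfolding b using F by (intro sum.mono_neutral_cong_left) (auto simp: y'_def \<beta>_zero)
  define d where "d t = x t + - y' t" for t
  have d: "d t \<in> A (sinv t)" if "t \<in> g" for t
    unfolding d_def by (intro ring_ideal_add[OF ideal] ring_ideal_uminus[OF ideal] x y' that)
  have "sum d g = 0"
    by (simp add: d_def sum_subtractf sum_y' eq)
  then have "(\<Sum>t\<in>g. \<beta> t (d t)) = 0"
    using sum_eq_zero_imp[OF g subset_refl d] by blast
  moreover have "\<beta> t (x t) = \<beta> t (d t) + \<beta> t (y' t)" if "t \<in> g" for t
    using \<beta>_add[OF d[OF that] y'] by (simp add: d_def)
  then have "(\<Sum>t\<in>g. \<beta> t (x t)) = (\<Sum>t\<in>g. \<beta> t (d t)) + (\<Sum>t\<in>g. \<beta> t (y' t))"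
    by (simp add: sum.distrib)
  ultimately show "b = (\<Sum>t\<in>g. \<beta> t (x t))"
    by (simp add: b')
qed

lemma \<alpha>_eq_\<beta>:
  assumes g: "g \<in> carrier G" and t: "t \<in> g" and x: "x \<in> A (sinv t)"
  shows "\<alpha> g x = \<beta> t x"
proof -
  let ?x = "\<lambda>r. if r = t then x else 0"
  have "\<alpha> g (\<Sum>r\<in>g. ?x r) = (\<Sum>r\<in>g. \<beta> r (?x r))"
    by (rule \<alpha>_sum[OF g]) (simp add: x ring_ideal_zero[OF ideal])
  also have "\<dots> = (\<Sum>r\<in>g. if r = t then \<beta> t x else 0)"
    by (intro sum.cong) (simp_all add: \<beta>_zero)
  finally show ?thesis
    by (simp add: t)
qed

lemma \<alpha>_add:
  assumes g: "g \<in> carrier G" and "x \<in> D (inv\<^bsub>G\<^esub> g)" "y \<in> D (inv\<^bsub>G\<^esub> g)"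
  shows "\<alpha> g (x + y) = \<alpha> g x + \<alpha> g y"
proof -
  obtain x' y' where x: "x = sum x' g" "\<And>t. t \<in> g \<Longrightarrow> x' t \<in> A (sinv t)"
    and y: "y = sum y' g" "\<And>t. t \<in> g \<Longrightarrow> y' t \<in> A (sinv t)"
    using assms(2,3) by (auto simp: D_inv[OF g])
  have "\<alpha> g (x + y) = \<alpha> g (\<Sum>t\<in>g. x' t + y' t)"
    by (simp add: x(1) y(1) sum.distrib)
  also have "\<dots> = (\<Sum>t\<in>g. \<beta> t (x' t + y' t))"
    by (rule \<alpha>_sum[OF g]) (simp add: ring_ideal_add[OF ideal] x y)
  also have "\<dots> = (\<Sum>t\<in>g. \<beta> t (x' t)) + (\<Sum>t\<in>g. \<beta> t (y' t))"
    by (simp add: sum.distrib[symmetric] \<beta>_add x(2) y(2))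
  finally show ?thesis
    by (simp add: x(1) y(1) \<alpha>_sum[OF g] x(2) y(2))
qed

lemma \<alpha>_sum_distrib:
  assumes "g \<in> carrier G" "\<And>i. i \<in> I \<Longrightarrow> x i \<in> D (inv\<^bsub>G\<^esub> g)"
  shows "\<alpha> g (sum x I) = (\<Sum>i\<in>I. \<alpha> g (x i))"
  by (rule additive_on_sum[where f = "\<alpha> g" and I = "D (inv\<^bsub>G\<^esub> g)"])
     (simp_all add: \<alpha>_add D_ideal assms)

lemma \<alpha>_mult:
  assumes g: "g \<in> carrier G" and "x \<in> D (inv\<^bsub>G\<^esub> g)" "y \<in> D (inv\<^bsub>G\<^esub> g)"
  shows "\<alpha> g (x * y) = \<alpha> g x * \<alpha> g y"
proof -
  obtain x' y' where x: "x = sum x' g" "\<And>t. t \<in> g \<Longrightarrow> x' t \<in> A (sinv t)"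
    and y: "y = sum y' g" "\<And>t. t \<in> g \<Longrightarrow> y' t \<in> A (sinv t)"
    using assms(2,3) by (auto simp: D_inv[OF g])
  have xy: "x' s * y' t \<in> A (sinv s)" if "s \<in> g" for s t
    by (rule ring_ideal_mult_right[OF ideal x(2)[OF that]])
  have D: "x' s * y' t \<in> D (inv\<^bsub>G\<^esub> g)" if "s \<in> g" for s t
    by (rule D_inv_summand[OF g that xy[OF that]])
  have "\<alpha> g (x * y) = (\<Sum>s\<in>g. \<Sum>t\<in>g. \<alpha> g (x' s * y' t))"
    by (simp add: x(1) y(1) sum_product \<alpha>_sum_distrib[OF g] ring_ideal_sum[OF D_ideal] D)
  also have "\<dots> = (\<Sum>s\<in>g. \<Sum>t\<in>g. \<beta> s (x' s) * \<beta> t (y' t))"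
    by (intro sum.cong refl)
       (simp add: \<alpha>_eq_\<beta>[OF g _ xy] \<beta>_mult_related[OF max_group_class_sigma[OF g] x(2) y(2)])
  finally show ?thesis
    by (simp add: x(1) y(1) \<alpha>_sum[OF g] x(2) y(2) sum_product)
qed

lemma \<alpha>_mem:
  assumes g: "g \<in> carrier G" and "x \<in> D (inv\<^bsub>G\<^esub> g)"
  shows "\<alpha> g x \<in> D g"
proof -
  obtain x' where x: "x = sum x' g" "\<And>t. t \<in> g \<Longrightarrow> x' t \<in> A (sinv t)"
    using assms(2) by (auto simp: D_inv[OF g])
  have "(\<Sum>t\<in>g. \<beta> t (x' t)) \<in> D g"
    by (rule ring_ideal_sum[OF D_ideal]) (rule D_summand, assumption, rule \<beta>_mem, rule x)
  then show ?thesis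
    by (simp add: x(1) \<alpha>_sum[OF g] x(2))
qed

text \<open>By additivity it suffices to treat the summands, where it is the statement that
  \<open>\<beta> (sinv t)\<close> inverts \<open>\<beta> t\<close>.\<close>

lemma \<alpha>_inv:
  assumes g: "g \<in> carrier G" and "x \<in> D (inv\<^bsub>G\<^esub> g)"
  shows "\<alpha> (inv\<^bsub>G\<^esub> g) (\<alpha> g x) = x"
proof -
  interpret group G by (rule group_max_group_image)
  have g': "inv\<^bsub>G\<^esub> g \<in> carrier G"
    using g by simp
  obtain x' where x: "x = sum x' g" "\<And>t. t \<in> g \<Longrightarrow> x' t \<in> A (sinv t)"
    using assms(2) by (auto simp: D_inv[OF g])
  have "\<alpha> (inv\<^bsub>G\<^esub> g) (\<beta> t (x' t)) = x' t" if t: "t \<in> g" for t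
    using \<alpha>_eq_\<beta>[OF g', of "sinv t" "\<beta> t (x' t)"] t \<beta>_mem[OF x(2)[OF t]] \<beta>_sinv[OF x(2)[OF t]]
    by (simp add: max_group_inv_eq_image[OF g])
  moreover have "\<beta> t (x' t) \<in> D (inv\<^bsub>G\<^esub> (inv\<^bsub>G\<^esub> g))" if "t \<in> g" for t
    using D_summand[OF that \<beta>_mem[OF x(2)[OF that]]] g by simp
  ultimately show ?thesis
    by (simp add: x(1) \<alpha>_sum[OF g] x(2) \<alpha>_sum_distrib[OF g'])
qed

lemma \<alpha>_iso:
  assumes g: "g \<in> carrier G"
  shows "ring_iso_betw (\<alpha> g) (D (inv\<^bsub>G\<^esub> g)) (D g)"
  unfolding ring_iso_betw_def
proof (intro conjI ballI)
  interpret group G by (rule group_max_group_image)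
  have g': "inv\<^bsub>G\<^esub> g \<in> carrier G"
    using g by simp
  show "bij_betw (\<alpha> g) (D (inv\<^bsub>G\<^esub> g)) (D g)"
    by (rule bij_betw_byWitness[where f' = "\<alpha> (inv\<^bsub>G\<^esub> g)"])
       (use \<alpha>_inv[OF g] \<alpha>_inv[OF g'] \<alpha>_mem[OF g] \<alpha>_mem[OF g'] g in auto)
qed (simp_all add: \<alpha>_add \<alpha>_mult g)

text \<open>Conditions (P2) and (P3), stated for \<open>y = \<alpha>\<^sub>h x\<close> rather than for \<open>x\<close>: starting in the middle
  lets both ideals that contain \<open>y\<close> be used. Membership in \<open>D h\<close> gives the decomposition of \<open>y\<close>
  along \<open>h\<close>, and multiplication by the unit of \<open>D (inv g)\<close> refines it along \<open>g\<close>.\<close>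

lemma \<alpha>_comp:
  assumes g: "g \<in> carrier G" and h: "h \<in> carrier G"
    and y: "y \<in> D (inv\<^bsub>G\<^esub> g)" "y \<in> D h"
  shows "\<alpha> (inv\<^bsub>G\<^esub> h) y \<in> D (inv\<^bsub>G\<^esub> (g \<otimes>\<^bsub>G\<^esub> h))"
    and "\<alpha> g y = \<alpha> (g \<otimes>\<^bsub>G\<^esub> h) (\<alpha> (inv\<^bsub>G\<^esub> h) y)"
proof -
  interpret group G by (rule group_max_group_image)
  have h': "inv\<^bsub>G\<^esub> h \<in> carrier G" and gh: "g \<otimes>\<^bsub>G\<^esub> h \<in> carrier G"
    using g h by simp_all
  obtain u where u: "u \<in> D (inv\<^bsub>G\<^esub> g)" "\<And>z. z \<in> D (inv\<^bsub>G\<^esub> g) \<Longrightarrow> u * z = z"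
    by (rule unital_ideal_sum_unit[where A = A and T = "inv\<^bsub>G\<^esub> g"])
      (use ideal unital in simp_all)
  obtain u' where u': "u = sum u' g" "\<And>s. s \<in> g \<Longrightarrow> u' s \<in> A (sinv s)"
    using u(1) by (auto simp: D_inv[OF g])
  obtain y' where y': "y = sum y' h" "\<And>t. t \<in> h \<Longrightarrow> y' t \<in> A t"
    using y(2) by (auto simp: ideal_sum_finite ideal)
  \<comment> \<open>The summands of \<open>u \<cdot> y\<close>; the one with index \<open>(s, t)\<close> lies in \<open>A (sinv s) \<inter> A t\<close>.\<close>
  define z where "z i = u' (fst i) * y' (snd i)" for i
  have "y = u * y"
    by (simp add: u(2) y(1))
  also have "\<dots> = sum z (g \<times> h)"
    by (simp add: z_def u'(1) y'(1) sum_product sum.cartesian_product split_def)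
  finally have yz: "y = sum z (g \<times> h)" .
  have z: "z (s, t) \<in> A (sinv s)" "z (s, t) \<in> A t" if "s \<in> g" "t \<in> h" for s t
    using that u'(2) y'(2) by (simp_all add: z_def ring_ideal_mult_left[OF ideal] ring_ideal_mult_right[OF ideal])
  have \<alpha>h': "\<alpha> (inv\<^bsub>G\<^esub> h) (z (s, t)) = \<beta> (sinv t) (z (s, t))" if "s \<in> g" "t \<in> h" for s t
    by (rule \<alpha>_eq_\<beta>[OF h']) (use that z in \<open>simp_all add: max_group_inv_eq_image[OF h]\<close>)
  have inv_z: "\<beta> t (\<beta> (sinv t) (z (s, t))) = z (s, t)" if "s \<in> g" "t \<in> h" for s t
    using \<beta>_sinv[of "z (s, t)" "sinv t"] z[OF that] by simp
  have dom: "\<beta> (sinv t) (z (s, t)) \<in> A (sinv (s * t))" if st: "s \<in> g" "t \<in> h" for s t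
    using \<beta>_mem[of "z (s, t)" "sinv t"] z[OF st] by (simp add: domain_comp inv_z[OF st])
  have mem: "\<alpha> (inv\<^bsub>G\<^esub> h) (z i) \<in> D (inv\<^bsub>G\<^esub> (g \<otimes>\<^bsub>G\<^esub> h))" if "i \<in> g \<times> h" for i
    using that \<alpha>h' D_inv_summand[OF gh max_group_mult_mem[OF g h] dom] by force
  have zh: "z i \<in> D (inv\<^bsub>G\<^esub> (inv\<^bsub>G\<^esub> h))" if "i \<in> g \<times> h" for i
    using that z(2) D_summand[where g = h] h by fastforce
  have zg: "z i \<in> D (inv\<^bsub>G\<^esub> g)" if "i \<in> g \<times> h" for i
    using that z(1) D_inv_summand[OF g] by fastforce
  have \<alpha>h'y: "\<alpha> (inv\<^bsub>G\<^esub> h) y = (\<Sum>i\<in>g \<times> h. \<alpha> (inv\<^bsub>G\<^esub> h) (z i))"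
    unfolding yz by (rule \<alpha>_sum_distrib[OF h' zh])
  show "\<alpha> (inv\<^bsub>G\<^esub> h) y \<in> D (inv\<^bsub>G\<^esub> (g \<otimes>\<^bsub>G\<^esub> h))"
    unfolding \<alpha>h'y by (rule ring_ideal_sum[OF D_ideal mem])
  have "\<alpha> (g \<otimes>\<^bsub>G\<^esub> h) (\<alpha> (inv\<^bsub>G\<^esub> h) (z i)) = \<alpha> g (z i)" if gh_i: "i \<in> g \<times> h" for i
  proof -
    obtain s t where i: "i = (s, t)" and st: "s \<in> g" "t \<in> h"
      using gh_i by auto
    have "\<alpha> (g \<otimes>\<^bsub>G\<^esub> h) (\<alpha> (inv\<^bsub>G\<^esub> h) (z i)) = \<beta> (s * t) (\<beta> (sinv t) (z (s, t)))"
      unfolding i \<alpha>h'[OF st] by (rule \<alpha>_eq_\<beta>[OF gh max_group_mult_mem[OF g h st] dom[OF st]])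
    also have "\<dots> = \<beta> s (z (s, t))"
      using comp[OF dom[OF st]] by (simp add: inv_z[OF st])
    finally show ?thesis
      by (simp add: i \<alpha>_eq_\<beta>[OF g st(1) z(1)[OF st]])
  qed
  then have "\<alpha> (g \<otimes>\<^bsub>G\<^esub> h) (\<alpha> (inv\<^bsub>G\<^esub> h) y) = (\<Sum>i\<in>g \<times> h. \<alpha> g (z i))"
    unfolding \<alpha>h'y using \<alpha>_sum_distrib[where x = "\<lambda>i. \<alpha> (inv\<^bsub>G\<^esub> h) (z i)", OF gh mem]
    by simp
  also have "\<dots> = \<alpha> g y"
    unfolding yz by (rule \<alpha>_sum_distrib[OF g zg, symmetric])
  finally show "\<alpha> g y = \<alpha> (g \<otimes>\<^bsub>G\<^esub> h) (\<alpha> (inv\<^bsub>G\<^esub> h) y)" ..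
qed

lemma D_one: "D \<one>\<^bsub>G\<^esub> = UNIV"
  by (simp add: E_unitary_max_group_one covering)

lemma \<alpha>_one: "\<alpha> \<one>\<^bsub>G\<^esub> x = x"
proof -
  interpret group G by (rule group_max_group_image)
  have "x \<in> D (inv\<^bsub>G\<^esub> \<one>\<^bsub>G\<^esub>)"
    by (simp add: D_one)
  then obtain y where y: "x = sum y \<one>\<^bsub>G\<^esub>" "\<And>t. t \<in> \<one>\<^bsub>G\<^esub> \<Longrightarrow> y t \<in> A (sinv t)"
    unfolding D_inv[OF one_closed] by blast
  have "\<beta> t (y t) = y t" if "t \<in> \<one>\<^bsub>G\<^esub>" for t
    using that y(2)[OF that] by (simp add: E_unitary_max_group_one \<beta>_idem sinv_idem)
  then show ?thesis
    by (simp add: y(1) \<alpha>_sum[OF one_closed y(2)])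
qed

theorem unital_partial_action_max_group_image: "unital_partial_action G D \<alpha>"
proof -
  interpret group G by (rule group_max_group_image)
  show ?thesis
  proof unfold_locales
    fix g h x assume g: "g \<in> carrier G" and h: "h \<in> carrier G"
    have *: "x \<in> D (inv\<^bsub>G\<^esub> (g \<otimes>\<^bsub>G\<^esub> h))" "\<alpha> g (\<alpha> h x) = \<alpha> (g \<otimes>\<^bsub>G\<^esub> h) x"
      if "x \<in> D (inv\<^bsub>G\<^esub> h)" "\<alpha> h x \<in> D (inv\<^bsub>G\<^esub> g) \<inter> D h" for x
      using \<alpha>_comp[OF g h, of "\<alpha> h x"] \<alpha>_inv[OF h] that by simp_all
    then show "{x \<in> D (inv\<^bsub>G\<^esub> h). \<alpha> h x \<in> D (inv\<^bsub>G\<^esub> g) \<inter> D h} \<subseteq> D (inv\<^bsub>G\<^esub> (g \<otimes>\<^bsub>G\<^esub> h))"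
      by blast
    show "\<alpha> g (\<alpha> h x) = \<alpha> (g \<otimes>\<^bsub>G\<^esub> h) x"
      if "x \<in> D (inv\<^bsub>G\<^esub> h)" "\<alpha> h x \<in> D (inv\<^bsub>G\<^esub> g) \<inter> D h"
      using *(2)[OF that] .
  qed (simp_all add: D_ideal \<alpha>_iso D_one \<alpha>_one unital_ideal_sum ideal unital)
qed

end

theorem theorem3p2:
  fixes scale :: "'k::comm_ring_1 \<Rightarrow> 'a::ring \<Rightarrow> 'a"
    and A :: "'s::{E_unitary_inverse_semigroup, finite} \<Rightarrow> 'a set"
    and \<beta> :: "'s \<Rightarrow> 'a \<Rightarrow> 'a"
  assumes "unital_inverse_semigroup_action scale A \<beta>"
    and "injective_action A \<beta>"
  shows "unital_partial_action (max_group_image :: 's set monoid)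
           (\<lambda>g. ideal_sum A g) (\<lambda>g. sum_of_maps A \<beta> g)"
proof -
  interpret unital_inverse_semigroup_action scale A \<beta>
    by (rule assms(1))
  interpret finite_E_unitary_unital_action scale A \<beta>
    by unfold_locales
  show ?thesis
    by (rule unital_partial_action_max_group_image)
qed

end
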